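(* Let $(X,\langle\cdot,\cdot\rangle)$ be a real Hilbert space with $X\neq\{0\}$ and let $G:X\to X$ be a continuous and invertible linear operator. Consider the equation $C=(GC)^{\circ}$ with an unknown subset $\emptyset\neq C\subseteq X$. The following statements hold: (i) Any solution $C$ of $C=(GC)^{\circ}$ is closed and convex, and contains $0$. (ii) If $G$ is positive definite, then there exists a unique solution $\emptyset\neq C\subseteq X$ of $C=(GC)^{\circ}$, and this solution is the ellipsoid $C=\{x\in X:\langle Gx,x\rangle\leq 1\}$. (iii) If $G$ is not positive definite, then there are cases where the equation has several (possibly infinitely many) solutions and cases where it has no solution in the class of bounded subsets of $X$ that contain $0$ in their interiors. That is: there exist a real Hilbert space $X\neq\{0\}$ and a continuous invertible linear operator $G:X\to X$ which is not positive definite such that $C=(GC)^{\circ}$ has more than one solution $\emptyset\neq C\subseteq X$, and for some such $X$ and $G$ the number of solutions is infinite; and there exist a real Hilbert space $X\neq\{0\}$ and a continuous invertible linear operator $G:X\to X$ which is not positive definite such that no bounded subset $C\subseteq X$ containing $0$ in its interior satisfies $C=(GC)^{\circ}$.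
   Context: For $\emptyset\neq S\subseteq X$, the polar of $S$ is $S^{\circ}:=\{x^*\in X:\langle x^*,s\rangle\leq 1\ \ \forall s\in S\}$, and $GS:=\{Gs: s\in S\}$. A continuous linear operator $G:X\to X$ is positive definite if it is self-adjoint ($G=G^*$) and $\langle Gx,x\rangle>0$ for all $0\neq x\in X$. A (centrally symmetric) ellipsoid in $X$ is a set of the form $\{x\in X:\langle Ax,x\rangle\leq 1\}$ for some positive definite $A:X\to X$. *)

theory Defs
  imports "HOL-Analysis.Analysis"
begin

text \<open>
  Real Hilbert spaces are types of sort \<open>{real_inner, complete_space}\<close>, and continuous linear
  operators are functions satisfying \<^const>\<open>bounded_linear\<close>.
\<close>

definition polar :: "'a::real_inner set \<Rightarrow> 'a set" where
  "polar S = {y. \<forall>s\<in>S. inner y s \<le> 1}"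

text \<open>
  The library constant \<^const>\<open>adjoint\<close> is defined by Hilbert choice: \<open>adjoint G\<close> is some map \<open>H\<close> with
  \<open>inner (G x) y = inner x (H y)\<close> for all \<open>x\<close>, \<open>y\<close>. On a Hilbert space such an \<open>H\<close> exists by the
  Riesz representation theorem and is unique.
\<close>

definition positive_definite :: "('a::{real_inner, complete_space} \<Rightarrow> 'a) \<Rightarrow> bool" where
  "positive_definite G \<longleftrightarrow>
     bounded_linear G \<and> G = adjoint G \<and> (\<forall>x. x \<noteq> 0 \<longrightarrow> inner (G x) x > 0)"

definition ellipsoid :: "'a::{real_inner, complete_space} set \<Rightarrow> bool" where
  "ellipsoid E \<longleftrightarrow> (\<exists>A. positive_definite A \<and> E = {x. inner (A x) x \<le> 1})"

definition polar_solution :: "('a::real_inner \<Rightarrow> 'a) \<Rightarrow> 'a set \<Rightarrow> bool" where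
  "polar_solution G C \<longleftrightarrow> C \<noteq> {} \<and> C = polar (G ` C)"

end

theory Submission
  imports Defs
begin

text \<open>
  Since \<open>polar S\<close> is an intersection of closed half-spaces containing the origin, every
  solution of \<open>C = polar (G ` C)\<close> is closed, convex and contains \<open>0\<close>.

  If \<open>G\<close> is positive definite, then \<open>inner (G x) y\<close> is an inner product, and the equation says that
  \<open>C\<close> is its own polar with respect to it. Testing an element of a solution \<open>C\<close> against itself gives
  \<open>C \<subseteq> E\<close>, where \<open>E\<close> is the unit ball of this inner product; by the Cauchy--Schwarz inequality,
  any two elements of \<open>E\<close> have product at most \<open>1\<close>, so that \<open>E \<subseteq> polar (G ` C) = C\<close>. Hence \<open>C = E\<close>.
  The symmetry of \<open>G\<close> has to be extracted from \<open>G = adjoint G\<close>, where \<^const>\<open>adjoint\<close>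
  has its defining property only because an adjoint exists; this existence is the Riesz
  representation theorem, proved here by minimising a quadratic functional.

  For the operators that are not positive definite, let first \<open>H\<close> be the rotation of the plane by
  a right angle. A line through the origin is mapped to its orthogonal complement, and the polar of
  a subspace is its orthogonal complement; so all the lines through the origin are solutions.
  For nonexistence, observe that a solution is mapped into itself by the cosquare \<open>T\<close> of \<open>H\<close> (the
  inverse of the adjoint of \<open>H\<close>, composed with \<open>H\<close>). For \<open>H (x, y) = (y, 2 x)\<close> this is
  \<open>T (x, y) = (2 x, y / 2)\<close>, whose powers drive any point \<open>(\<epsilon>, 0)\<close> with \<open>\<epsilon> > 0\<close> to infinity.
\<close>

section \<open>Polars and the cosquare\<close>

lemma polar_eq_Inter_halfspaces: "polar S = (\<Inter>s\<in>S. {y. inner s y \<le> 1})"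
  by (auto simp: polar_def inner_commute)

lemma closed_polar: "closed (polar S)"
  unfolding polar_eq_Inter_halfspaces by (intro closed_INT ballI closed_halfspace_le)

lemma convex_polar: "convex (polar S)"
  unfolding polar_eq_Inter_halfspaces by (intro convex_INT convex_halfspace_le)

lemma zero_in_polar: "0 \<in> polar S"
  by (simp add: polar_def)

text \<open>
  The hypothesis on \<open>T\<close> says that \<open>T\<close> is the cosquare of \<open>G\<close>. It turns the test of \<open>T s\<close> against
  \<open>G s'\<close> into the test of \<open>s'\<close> against \<open>G s\<close>, which \<open>s'\<close> passes because it belongs to the polar.
\<close>

lemma cosquare_maps_solution_into_itself:
  assumes C: "C = polar (G ` C)"
    and T: "\<And>x y. inner (T x) (G y) = inner (G x) y"
    and s: "s \<in> C"
  shows "T s \<in> C"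
proof -
  have "inner (T s) (G s') \<le> 1" if "s' \<in> C" for s'
  proof -
    have "s' \<in> polar (G ` C)"
      using that C by simp
    then have "inner s' (G s) \<le> 1"
      using s by (simp add: polar_def)
    then show ?thesis
      using T[of s s'] by (simp add: inner_commute)
  qed
  then have "T s \<in> polar (G ` C)"
    by (simp add: polar_def)
  then show ?thesis
    using C by simp
qed

section \<open>Riesz representation and the adjoint\<close>

text \<open>
  The representing vector is the minimiser of \<open>J x = (norm x)\<^sup>2 / 2 - f x\<close>. By the parallelogram law
  the midpoint \<open>z\<close> of \<open>x\<close> and \<open>y\<close> satisfies \<open>(norm (x - y))\<^sup>2 / 4 = J x + J y - 2 * J z\<close>, so
  minimising sequences are Cauchy; at the minimiser the directional derivative
  \<open>inner u h - f h\<close> vanishes for each \<open>h\<close>.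
\<close>

lemma riesz_representation:
  fixes f :: "'a::{real_inner, complete_space} \<Rightarrow> real"
  assumes f: "bounded_linear f"
  obtains u where "\<And>x. f x = inner x u"
proof -
  interpret f: bounded_linear f by (rule f)
  define J where "J x = (norm x)\<^sup>2 / 2 - f x" for x
  obtain K where K: "\<And>x. norm (f x) \<le> norm x * K"
    using f.bounded by blast
  have lower: "- (K\<^sup>2 / 2) \<le> J x" for x
  proof -
    have "f x \<le> norm x * K"
      using K[of x] by simp
    moreover have "0 \<le> (norm x - K)\<^sup>2"
      by simp
    ultimately show ?thesis
      unfolding J_def by (simp add: power2_diff)
  qed
  define m where "m = (INF x. J x)"
  have bdd: "bdd_below (range J)"
    using lower by (auto intro!: bdd_belowI)
  have m_le: "m \<le> J x" for x
    unfolding m_def using bdd by (rule cINF_lower) simp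
  have "\<exists>x. J x < m + 1 / real (Suc n)" for n
  proof -
    have "(INF x. J x) < m + 1 / real (Suc n)"
      by (simp add: m_def)
    then show ?thesis
      using cINF_less_iff[of UNIV J] bdd by auto
  qed
  then obtain X where X: "\<And>n. J (X n) < m + 1 / real (Suc n)"
    by metis
  have mid: "(norm (x - y))\<^sup>2 / 4 = J x + J y - 2 * J ((1/2) *\<^sub>R (x + y))" for x y
    unfolding J_def f.scaleR f.add power2_norm_eq_inner
    by (simp add: inner_simps inner_commute field_simps)
  have dist_X: "(norm (X i - X j))\<^sup>2 \<le> 4 * (1 / real (Suc i) + 1 / real (Suc j))" for i j
    using mid[of "X i" "X j"] X[of i] X[of j] m_le[of "(1/2) *\<^sub>R (X i + X j)"] by argo
  have "Cauchy X"
  proof (rule metric_CauchyI)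
    fix e :: real
    assume e: "0 < e"
    obtain N where N: "inverse (real (Suc N)) < e\<^sup>2 / 8"
      using reals_Archimedean[of "e\<^sup>2 / 8"] e by auto
    have "dist (X i) (X j) < e" if "N \<le> i" "N \<le> j" for i j
    proof -
      have "1 / real (Suc i) \<le> 1 / real (Suc N)" "1 / real (Suc j) \<le> 1 / real (Suc N)"
        using that by (auto simp: frac_le)
      then have "(norm (X i - X j))\<^sup>2 < e\<^sup>2"
        using dist_X[of i j] N by (simp add: inverse_eq_divide)
      then show ?thesis
        using e by (simp add: dist_norm power2_less_imp_less)
    qed
    then show "\<exists>N. \<forall>i\<ge>N. \<forall>j\<ge>N. dist (X i) (X j) < e"
      by blast
  qed
  then obtain u where u: "X \<longlonglongrightarrow> u"
    using Cauchy_convergent convergent_def by blast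
  have "(\<lambda>n. J (X n)) \<longlonglongrightarrow> J u"
    unfolding J_def by (intro tendsto_intros f.tendsto u) simp
  moreover have "(\<lambda>n. m + 1 / real (Suc n)) \<longlonglongrightarrow> m + 0"
    by (intro tendsto_add tendsto_const LIMSEQ_Suc[OF lim_1_over_n])
  ultimately have "J u \<le> m + 0"
    by (rule LIMSEQ_le) (meson X less_imp_le)
  then have min: "J u \<le> J x" for x
    using m_le[of x] by simp
  have "f h = inner h u" for h
  proof -
    define d where "d = inner h u - f h"
    have nonneg: "0 \<le> t * d + t\<^sup>2 * (inner h h / 2)" for t
    proof -
      have "J (u + t *\<^sub>R h) - J u = t * d + t\<^sup>2 * (inner h h / 2)"
        unfolding J_def d_def f.scaleR f.add power2_norm_eq_inner
        by (simp add: inner_simps inner_commute field_simps power2_eq_square)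
      then show ?thesis
        using min[of "u + t *\<^sub>R h"] by simp
    qed
    \<comment> \<open>The summand \<open>1\<close> keeps the denominator of the step size positive also in the case \<open>h = 0\<close>.\<close>
    define w where "w = inner h h + 1"
    define t where "t = - (d / w)"
    have w: "0 < w"
      by (simp add: w_def add_nonneg_pos)
    have "t * d + t\<^sup>2 * (inner h h / 2) \<le> t * d + t\<^sup>2 * (w / 2)"
      by (intro add_left_mono mult_left_mono) (auto simp: w_def)
    also have "\<dots> = - (d\<^sup>2 / (2 * w))"
      unfolding t_def using w by (simp add: field_simps power2_eq_square)
    finally have "d\<^sup>2 / (2 * w) \<le> 0"
      using nonneg[of t] by simp
    then have "d = 0"
      using w by (simp add: divide_le_0_iff)
    then show ?thesis
      by (simp add: d_def)
  qed
  then show ?thesis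
    using that by blast
qed

lemma inner_adjoint_Hilbert:
  fixes G :: "'a::{real_inner, complete_space} \<Rightarrow> 'b::real_inner"
  assumes "bounded_linear G"
  shows "inner (G x) y = inner x (adjoint G y)"
proof -
  have "\<exists>u. \<forall>x. inner (G x) y = inner x u" for y
  proof -
    have "bounded_linear (\<lambda>x. inner (G x) y)"
      by (rule bounded_linear_compose[OF bounded_linear_inner_left assms])
    then show ?thesis
      by (metis riesz_representation)
  qed
  then obtain G' where "\<forall>x y. inner (G x) y = inner x (G' y)"
    by metis
  then have "\<forall>x y. inner (G x) y = inner x (adjoint G y)"
    unfolding adjoint_def by (rule someI[where P = "\<lambda>G'. \<forall>x y. inner (G x) y = inner x (G' y)"])
  then show ?thesis
    by blast
qed

section \<open>Positive definite operators\<close>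

lemma positive_definite_symmetric:
  assumes "positive_definite G"
  shows "inner (G x) y = inner x (G y)"
  using assms inner_adjoint_Hilbert[of G x y] by (simp add: positive_definite_def)

lemma positive_definite_nonneg:
  assumes "positive_definite G"
  shows "0 \<le> inner (G x) x"
  using assms by (cases "x = 0") (auto simp: positive_definite_def intro: less_imp_le)

text \<open>
  This is the Cauchy--Schwarz inequality for the inner product induced by \<open>G\<close>, restricted to its
  unit ball, where it already follows from \<open>0 \<le> inner (G (x - y)) (x - y)\<close>.
\<close>

lemma positive_definite_Cauchy_Schwarz_unit_ball:
  assumes G: "positive_definite G"
    and "inner (G x) x \<le> 1" "inner (G y) y \<le> 1"
  shows "inner x (G y) \<le> 1"
proof -
  interpret G: bounded_linear G
    using G by (simp add: positive_definite_def)
  have "0 \<le> inner (G (x - y)) (x - y)"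
    by (rule positive_definite_nonneg[OF G])
  also have "\<dots> = inner (G x) x + inner (G y) y - 2 * inner x (G y)"
    using positive_definite_symmetric[OF G, of x y]
    by (simp add: G.diff inner_simps inner_commute)
  finally show ?thesis
    using assms by linarith
qed

text \<open>
  A nonzero \<open>y\<close> in the polar of the image of the unit ball lies in the unit ball, because its
  normalisation is an admissible test vector.
\<close>

lemma ellipsoid_is_polar_solution:
  assumes G: "positive_definite G"
  shows "polar_solution G {x. inner (G x) x \<le> 1}" (is "polar_solution G ?E")
proof -
  interpret G: bounded_linear G
    using G by (simp add: positive_definite_def)
  have "y \<in> ?E" if y: "y \<in> polar (G ` ?E)" for y
  proof (cases "y = 0")
    case True
    then show ?thesis
      by simp
  next
    case False
    define r where "r = sqrt (inner (G y) y)"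
    have pos: "0 < inner (G y) y"
      using G False by (simp add: positive_definite_def)
    then have r: "0 < r" "inner (G y) y = r * r"
      by (simp_all add: r_def)
    have "(1 / r) *\<^sub>R y \<in> ?E"
      using r by (simp add: G.scaleR)
    then have "inner y (G ((1 / r) *\<^sub>R y)) \<le> 1"
      using y unfolding polar_def by blast
    then have "r \<le> 1"
      using r by (simp add: G.scaleR inner_commute)
    then show ?thesis
      using r mult_le_one[of r r] by simp
  qed
  moreover have "?E \<subseteq> polar (G ` ?E)"
    using positive_definite_Cauchy_Schwarz_unit_ball[OF G] by (auto simp: polar_def)
  moreover have "0 \<in> ?E"
    by simp
  ultimately show ?thesis
    unfolding polar_solution_def by blast
qed

lemma polar_solution_unique:
  assumes G: "positive_definite G" and C: "polar_solution G C"
  shows "C = {x. inner (G x) x \<le> 1}"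
proof -
  have mem: "x \<in> C \<longleftrightarrow> (\<forall>s\<in>C. inner x (G s) \<le> 1)" for x
    using C unfolding polar_solution_def polar_def by blast
  have sub: "inner (G x) x \<le> 1" if "x \<in> C" for x
    using mem[of x] that by (simp add: inner_commute)
  moreover have "x \<in> C" if "inner (G x) x \<le> 1" for x
    using mem[of x] sub positive_definite_Cauchy_Schwarz_unit_ball[OF G that] by blast
  ultimately show ?thesis
    by blast
qed

section \<open>The rotation by a right angle has infinitely many solutions\<close>

definition rot90 :: "real^2 \<Rightarrow> real^2" where
  "rot90 z = vector [- z$2, z$1]"

lemma rot90_nth [simp]: "rot90 z $ 1 = - z$2" "rot90 z $ 2 = z$1"
  by (simp_all add: rot90_def)

lemma bounded_linear_rot90: "bounded_linear rot90"
proof -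
  have "linear rot90"
    by (rule linearI) (simp_all add: vec_eq_iff forall_2)
  then show ?thesis
    by (rule linear_conv_bounded_linear[THEN iffD1])
qed

lemma bij_rot90: "bij rot90"
  by (rule o_bij[where g = "\<lambda>z. vector [z$2, - z$1]"])
    (simp_all add: fun_eq_iff vec_eq_iff forall_2)

lemma not_positive_definite_rot90: "\<not> positive_definite rot90"
proof
  assume "positive_definite rot90"
  moreover have "vector [1, 0] \<noteq> (0 :: real^2)"
    by (simp add: vec_eq_iff forall_2)
  ultimately have "0 < inner (rot90 (vector [1, 0])) (vector [1, 0])"
    unfolding positive_definite_def by blast
  then show False
    by (simp add: inner_vec_def sum_2)
qed

text \<open>
  On a line through the origin the functional \<open>inner z (rot90 s)\<close> of \<open>s\<close> is linear, so it is
  bounded above by \<open>1\<close> only if it vanishes there, that is, only if \<open>z\<close> lies on the line.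
\<close>

lemma line_polar_solution_rot90: "polar_solution rot90 {z. z$2 = t * z$1}" (is "polar_solution _ ?L")
proof -
  have "z \<in> ?L" if z: "z \<in> polar (rot90 ` ?L)" for z
  proof -
    define d where "d = z$2 - t * z$1"
    have test: "r * d \<le> 1" for r
    proof -
      have "vector [r, t * r] \<in> ?L"
        by simp
      then have "inner z (rot90 (vector [r, t * r])) \<le> 1"
        using z unfolding polar_def by blast
      then show ?thesis
        by (simp add: inner_vec_def sum_2 d_def algebra_simps)
    qed
    have "d = 0"
      using test[of "2 / d"] by (cases "d = 0") auto
    then show ?thesis
      by (simp add: d_def)
  qed
  moreover have "?L \<subseteq> polar (rot90 ` ?L)"
    by (auto simp: polar_def inner_vec_def sum_2)
  moreover have "0 \<in> ?L"
    by simp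
  ultimately show ?thesis
    unfolding polar_solution_def by blast
qed

lemma inj_line_of_slope: "inj (\<lambda>t. {z :: real^2. z$2 = t * z$1})"
proof (rule injI)
  fix t t' :: real
  assume "{z :: real^2. z$2 = t * z$1} = {z. z$2 = t' * z$1}"
  moreover have "vector [1, t] \<in> {z :: real^2. z$2 = t * z$1}"
    by simp
  ultimately have "vector [1, t] \<in> {z :: real^2. z$2 = t' * z$1}"
    by blast
  then show "t = t'"
    by simp
qed

lemma infinite_polar_solutions_rot90: "infinite {C. polar_solution rot90 C}"
proof -
  have "infinite (range (\<lambda>t. {z :: real^2. z$2 = t * z$1}))"
    using finite_imageD[OF _ inj_line_of_slope] infinite_UNIV_char_0 by blast
  moreover have "range (\<lambda>t. {z :: real^2. z$2 = t * z$1}) \<subseteq> {C. polar_solution rot90 C}"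
    using line_polar_solution_rot90 by blast
  ultimately show ?thesis
    using infinite_super by blast
qed

section \<open>An operator whose cosquare has unbounded orbits\<close>

definition swap_stretch :: "real^2 \<Rightarrow> real^2" where
  "swap_stretch z = vector [z$2, 2 * z$1]"

lemma swap_stretch_nth [simp]: "swap_stretch z $ 1 = z$2" "swap_stretch z $ 2 = 2 * z$1"
  by (simp_all add: swap_stretch_def)

lemma bounded_linear_swap_stretch: "bounded_linear swap_stretch"
proof -
  have "linear swap_stretch"
    by (rule linearI) (simp_all add: vec_eq_iff forall_2)
  then show ?thesis
    by (rule linear_conv_bounded_linear[THEN iffD1])
qed

lemma bij_swap_stretch: "bij swap_stretch"
  by (rule o_bij[where g = "\<lambda>z. vector [z$2 / 2, z$1]"])
    (simp_all add: fun_eq_iff vec_eq_iff forall_2)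

lemma not_positive_definite_swap_stretch: "\<not> positive_definite swap_stretch"
proof
  assume "positive_definite swap_stretch"
  moreover have "vector [1, 0] \<noteq> (0 :: real^2)"
    by (simp add: vec_eq_iff forall_2)
  ultimately have "0 < inner (swap_stretch (vector [1, 0])) (vector [1, 0])"
    unfolding positive_definite_def by blast
  then show False
    by (simp add: inner_vec_def sum_2)
qed

lemma no_bounded_polar_solution_swap_stretch:
  assumes bdd: "bounded C" and int: "0 \<in> interior C" and C: "C = polar (swap_stretch ` C)"
  shows False
proof -
  have cosquare: "inner (vector [2 * x$1, x$2 / 2]) (swap_stretch y) = inner (swap_stretch x) y"
    for x y :: "real^2"
    by (simp add: inner_vec_def sum_2)
  have step: "vector [2 * x$1, x$2 / 2] \<in> C" if "x \<in> C" for x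
    using C cosquare that by (rule cosquare_maps_solution_into_itself)
  obtain e where e: "0 < e" "cball 0 e \<subseteq> C"
    using int by (auto simp: mem_interior_cball)
  have orbit: "vector [2 ^ n * e, 0] \<in> C" for n
  proof (induction n)
    case 0
    have "norm (vector [e, 0] :: real^2) = e"
      using e by (simp add: norm_vec_def L2_set_def sum_2)
    then have "vector [e, 0] \<in> (cball 0 e :: (real^2) set)"
      by simp
    then show ?case
      using e by auto
  next
    case (Suc n)
    then show ?case
      using step[OF Suc] by (simp add: mult.assoc)
  qed
  obtain B where B: "\<And>x. x \<in> C \<Longrightarrow> norm x \<le> B"
    using bdd by (auto simp: bounded_iff)
  obtain n :: nat where n: "B / e < 2 ^ n"
    using real_arch_pow[of 2 "B / e"] by auto
  have "2 ^ n * e \<le> norm (vector [2 ^ n * e, 0] :: real^2)"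
    using e by (simp add: norm_vec_def L2_set_def sum_2)
  also have "\<dots> \<le> B"
    by (rule B[OF orbit])
  finally show False
    using n e by (simp add: divide_less_eq)
qed

section \<open>Solutions of the polar equation\<close>

theorem theorem1p1:
  fixes G :: "'a::{real_inner, complete_space} \<Rightarrow> 'a"
  assumes "(UNIV :: 'a set) \<noteq> {0}"
    and "bounded_linear G" and "bij G"
  shows "(\<forall>C. polar_solution G C \<longrightarrow> closed C \<and> convex C \<and> 0 \<in> C)
    \<and> (positive_definite G \<longrightarrow>
         (\<exists>!C. polar_solution G C) \<and>
         polar_solution G {x. inner (G x) x \<le> 1} \<and>
         ellipsoid {x. inner (G x) x \<le> 1})
    \<and> (\<exists>H :: real^2 \<Rightarrow> real^2. bounded_linear H \<and> bij H \<and> \<not> positive_definite H \<and>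
         (\<exists>C D. C \<noteq> D \<and> polar_solution H C \<and> polar_solution H D))
    \<and> (\<exists>H :: real^2 \<Rightarrow> real^2. bounded_linear H \<and> bij H \<and> \<not> positive_definite H \<and>
         infinite {C. polar_solution H C})
    \<and> (\<exists>H :: real^2 \<Rightarrow> real^2. bounded_linear H \<and> bij H \<and> \<not> positive_definite H \<and>
         \<not> (\<exists>C. bounded C \<and> 0 \<in> interior C \<and> C = polar (H ` C)))"
proof (intro conjI)
  show "\<forall>C. polar_solution G C \<longrightarrow> closed C \<and> convex C \<and> 0 \<in> C"
    unfolding polar_solution_def by (metis closed_polar convex_polar zero_in_polar)
  show "positive_definite G \<longrightarrow>
         (\<exists>!C. polar_solution G C) \<and>
         polar_solution G {x. inner (G x) x \<le> 1} \<and>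
         ellipsoid {x. inner (G x) x \<le> 1}"
    using ellipsoid_is_polar_solution polar_solution_unique unfolding ellipsoid_def by blast
  have "{z :: real^2. z$2 = 0 * z$1} \<noteq> {z. z$2 = 1 * z$1}"
    using injD[OF inj_line_of_slope, of 0 1] by auto
  then show "\<exists>H :: real^2 \<Rightarrow> real^2. bounded_linear H \<and> bij H \<and> \<not> positive_definite H \<and>
         (\<exists>C D. C \<noteq> D \<and> polar_solution H C \<and> polar_solution H D)"
    using bounded_linear_rot90 bij_rot90 not_positive_definite_rot90
      line_polar_solution_rot90[of 0] line_polar_solution_rot90[of 1]
    by (intro exI[of _ rot90] conjI exI) assumption+
  show "\<exists>H :: real^2 \<Rightarrow> real^2. bounded_linear H \<and> bij H \<and> \<not> positive_definite H \<and>
         infinite {C. polar_solution H C}"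
    using bounded_linear_rot90 bij_rot90 not_positive_definite_rot90 infinite_polar_solutions_rot90
    by (intro exI[of _ rot90] conjI)
  show "\<exists>H :: real^2 \<Rightarrow> real^2. bounded_linear H \<and> bij H \<and> \<not> positive_definite H \<and>
         \<not> (\<exists>C. bounded C \<and> 0 \<in> interior C \<and> C = polar (H ` C))"
    using bounded_linear_swap_stretch bij_swap_stretch not_positive_definite_swap_stretch
      no_bounded_polar_solution_swap_stretch
    by (intro exI[of _ swap_stretch] conjI) blast+
qed

end
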